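(* Let $A,B\in\mathcal{M}_n$ be positive definite, let $X\in\mathcal{M}_n$ and $0\leq \nu\leq 1$. If there are two positive numbers $m,M$ such that $m\leq A\leq M$ and $m\leq B\leq M$ (that is, $mI\le A\le MI$ and $mI\le B\le MI$), then $$\left\|\frac{A^{\nu}XB^{1-\nu}+A^{1-\nu}XB^{\nu}}{2}\right\|_2\leq \left(\frac{m+M}{2\sqrt{mM}}\right)^{1-\nu}\left\|(1-\nu)A^{\frac{1}{2}}XB^{\frac{1}{2}}+\nu\,\frac{AX+XB}{2}\right\|_2.$$
   Context: $\mathcal{M}_n$ is the algebra of $n\times n$ complex matrices, inequalities between Hermitian matrices are in the Löwner order, and $\|\cdot\|_2$ is the Schatten $2$-norm (Hilbert–Schmidt/Frobenius norm). *)

theory Defs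
  imports Complex_Main "Jordan_Normal_Form.Schur_Decomposition"
begin

definition mat_trace :: "complex mat \<Rightarrow> complex" where
  "mat_trace A = (\<Sum>i<dim_row A. A $$ (i, i))"

text \<open>The Schatten 2-norm, \<open>(tr |X|\<^sup>2)\<close> to the power \<open>1/2\<close>, with \<open>|X|\<^sup>2 = X\<^sup>* X\<close>.
  The trace is real and nonnegative, so \<^const>\<open>Re\<close> discards nothing.\<close>

definition schatten2_norm :: "complex mat \<Rightarrow> real" where
  "schatten2_norm X = sqrt (Re (mat_trace (mat_adjoint X * X)))"

text \<open>A hermitian matrix is square: \<^const>\<open>mat_adjoint\<close> swaps the dimensions.\<close>

definition hermitian :: "complex mat \<Rightarrow> bool" where
  "hermitian A \<longleftrightarrow> mat_adjoint A = A"

definition pos_semidefinite :: "complex mat \<Rightarrow> bool" where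
  "pos_semidefinite A \<longleftrightarrow>
     hermitian A \<and> (\<forall>v \<in> carrier_vec (dim_row A). 0 \<le> Re ((A *\<^sub>v v) \<bullet>c v))"

definition pos_definite :: "complex mat \<Rightarrow> bool" where
  "pos_definite A \<longleftrightarrow>
     hermitian A \<and>
     (\<forall>v \<in> carrier_vec (dim_row A). v \<noteq> 0\<^sub>v (dim_row A) \<longrightarrow> 0 < Re ((A *\<^sub>v v) \<bullet>c v))"

definition loewner_le :: "complex mat \<Rightarrow> complex mat \<Rightarrow> bool" where
  "loewner_le A B \<longleftrightarrow>
     hermitian A \<and> hermitian B \<and> dim_row A = dim_row B \<and> pos_semidefinite (B - A)"

abbreviation scalar_mat :: "nat \<Rightarrow> real \<Rightarrow> complex mat" where
  "scalar_mat n c \<equiv> complex_of_real c \<cdot>\<^sub>m 1\<^sub>m n"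

definition unitary_mat :: "nat \<Rightarrow> complex mat \<Rightarrow> bool" where
  "unitary_mat n U \<longleftrightarrow>
     U \<in> carrier_mat n n \<and> mat_adjoint U * U = 1\<^sub>m n \<and> U * mat_adjoint U = 1\<^sub>m n"

definition spectral_decomp :: "nat \<Rightarrow> complex mat \<Rightarrow> complex mat \<Rightarrow> (nat \<Rightarrow> real) \<Rightarrow> bool" where
  "spectral_decomp n A U d \<longleftrightarrow>
     unitary_mat n U \<and> A = U * mat_diag n (\<lambda>i. complex_of_real (d i)) * mat_adjoint U"

text \<open>Functional calculus of a hermitian matrix: \<open>f(A) = U diag(f(d\<^sub>i)) U\<^sup>*\<close> whenever
  \<open>A = U diag(d\<^sub>i) U\<^sup>*\<close>. Independence of the decomposition is proved below.\<close>

definition mat_fun :: "(real \<Rightarrow> real) \<Rightarrow> complex mat \<Rightarrow> complex mat" where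
  "mat_fun f A = (THE P. \<exists>U d. spectral_decomp (dim_row A) A U d \<and>
     P = U * mat_diag (dim_row A) (\<lambda>i. complex_of_real (f (d i))) * mat_adjoint U)"

text \<open>To be used for positive definite \<open>A\<close> only, where all eigenvalues are positive; then
  \<open>A\<close> to the power 0 is the identity.\<close>

definition mat_powr :: "complex mat \<Rightarrow> real \<Rightarrow> complex mat" where
  "mat_powr A t = mat_fun (\<lambda>x. x powr t) A"

lemma mat_adjoint_carrier:
  "U \<in> carrier_mat n m \<Longrightarrow> mat_adjoint U \<in> carrier_mat m n"
  unfolding mat_adjoint_def by auto

lemma spectral_decomp_unique:
  assumes 1: "spectral_decomp n A U d" and 2: "spectral_decomp n A V e"
  shows "U * mat_diag n (\<lambda>i. complex_of_real (f (d i))) * mat_adjoint U =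
         V * mat_diag n (\<lambda>i. complex_of_real (f (e i))) * mat_adjoint V"
proof -
  define D where "D = mat_diag n (\<lambda>i. complex_of_real (d i))"
  define E where "E = mat_diag n (\<lambda>i. complex_of_real (e i))"
  define D' where "D' = mat_diag n (\<lambda>i. complex_of_real (f (d i)))"
  define E' where "E' = mat_diag n (\<lambda>i. complex_of_real (f (e i)))"
  define U' where "U' = mat_adjoint U"
  define V' where "V' = mat_adjoint V"
  define W where "W = V' * U"
  have U: "U \<in> carrier_mat n n" "U' * U = 1\<^sub>m n" "U * U' = 1\<^sub>m n" and A1: "A = U * D * U'"
    using 1 unfolding spectral_decomp_def unitary_mat_def D_def U'_def by auto
  have V: "V \<in> carrier_mat n n" "V' * V = 1\<^sub>m n" "V * V' = 1\<^sub>m n" and A2: "A = V * E * V'"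
    using 2 unfolding spectral_decomp_def unitary_mat_def E_def V'_def by auto
  have c: "U' \<in> carrier_mat n n" "V' \<in> carrier_mat n n" "W \<in> carrier_mat n n"
    "D \<in> carrier_mat n n" "E \<in> carrier_mat n n" "D' \<in> carrier_mat n n" "E' \<in> carrier_mat n n"
    using U(1) mat_adjoint_carrier[OF U(1)] mat_adjoint_carrier[OF V(1)]
    unfolding U'_def V'_def W_def D_def E_def D'_def E'_def by auto
  note a = assoc_mult_mat[where ?n\<^sub>1.0 = n and ?n\<^sub>2.0 = n and ?n\<^sub>3.0 = n and ?n\<^sub>4.0 = n]
  note m = mult_carrier_mat[where nr = n and n = n and nc = n]
  have "V' * A * U = W * D * (U' * U)"
    unfolding A1 W_def using U(1) c by (simp add: a m)
  then have l: "V' * A * U = W * D" using U(2) c m by simp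
  have "V' * A * U = (V' * V) * E * W"
    unfolding A2 W_def using U(1) V(1) c by (simp add: a m)
  then have r: "V' * A * U = E * W" using V(2) c m by simp
  have WE: "W * D = E * W" using l r by simp
  have ent: "W $$ (i, j) * complex_of_real (d j) = complex_of_real (e i) * W $$ (i, j)"
    if "i < n" "j < n" for i j
    using arg_cong[OF WE, of "\<lambda>X. X $$ (i, j)"] that c(3)
    unfolding D_def E_def
    by (simp add: mat_diag_mult_left[of _ n n] mat_diag_mult_right[of _ n n])
  have "W $$ (i, j) * complex_of_real (f (d j)) = complex_of_real (f (e i)) * W $$ (i, j)"
    if "i < n" "j < n" for i j
    using ent[OF that] by (cases "W $$ (i, j) = 0") auto
  then have WE': "W * D' = E' * W"
    using c(3) unfolding D'_def E'_def
    by (intro eq_matI) (auto simp: mat_diag_mult_left[of _ n n] mat_diag_mult_right[of _ n n])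
  have "U * D' * U' = (V * V') * (U * D' * U')" using U(1) V(3) c m by simp
  also have "\<dots> = V * (W * D') * U'" unfolding W_def using U(1) V(1) c by (simp add: a m)
  also have "\<dots> = V * E' * V' * (U * U')"
    unfolding WE' unfolding W_def using U(1) V(1) c by (simp add: a m)
  also have "\<dots> = V * E' * V'" using U(3) V(1) c m by simp
  finally show ?thesis unfolding U'_def V'_def D'_def E'_def .
qed

lemma mat_fun_eq:
  assumes "spectral_decomp n A U d"
  shows "mat_fun f A = U * mat_diag n (\<lambda>i. complex_of_real (f (d i))) * mat_adjoint U"
proof -
  have n: "dim_row A = n"
    using assms unfolding spectral_decomp_def unitary_mat_def by auto
  show ?thesis
    unfolding mat_fun_def n
    by (rule the_equality) (use assms spectral_decomp_unique in blast)+
qed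

end

theory Submission
  imports Defs "Jordan_Normal_Form.Spectral_Radius" "HOL-Analysis.Convex"
begin

text \<open>
  Diagonalise \<open>A = U diag(a\<^sub>i) U\<^sup>*\<close> and \<open>B = V diag(b\<^sub>j) V\<^sup>*\<close> with unitary \<open>U\<close>, \<open>V\<close>, and put
  \<open>Y = U\<^sup>* X V\<close>. Then \<open>f(A) X g(B) = U [f(a\<^sub>i) g(b\<^sub>j) Y\<^sub>i\<^sub>j] V\<^sup>*\<close>, so both matrices in the theorem arise
  from \<open>Y\<close> by weighting its entries: on the left with the Heinz mean of \<open>a\<^sub>i\<close> and \<open>b\<^sub>j\<close>, on the
  right with \<open>(1 - \<nu>)\<close> times their geometric plus \<open>\<nu>\<close> times their arithmetic mean. The Schatten
  2-norm is unitarily invariant and equals the Euclidean norm of the entries. The theorem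
  therefore reduces to an inequality between numbers \<open>a, b\<close> in \<open>[m, M]\<close>
  (\<open>heinz_mean_le\<close>), and the reduction is \<open>schatten2_norm_schur_multiplier_mono\<close>.

  For that inequality let \<open>c\<close> be the ratio of the arithmetic to the geometric mean of \<open>a\<close> and
  \<open>b\<close>, and \<open>K = (m + M) / (2 sqrt(m M))\<close> its value at \<open>(m, M)\<close>, which is its maximum for \<open>a, b\<close> in
  \<open>[m, M]\<close>. In units of the geometric mean, the right-hand side is \<open>K\<^sup>1\<^sup>-\<^sup>\<nu> (1 - \<nu> + \<nu> c)\<close>. It is at
  least \<open>c\<^sup>1\<^sup>-\<^sup>\<nu> c\<^sup>\<nu> = c\<close> by Young's inequality, and \<open>c\<close> dominates the Heinz mean, again by Young's
  inequality.

  What remains is the spectral theorem for Hermitian matrices, obtained by deflation in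
  \<open>hermitian_spectral_decomp\<close>, and the fact that the Loewner bounds on \<open>A\<close> and \<open>B\<close> are bounds on
  their eigenvalues.
\<close>

section \<open>Adjoints and unitary matrices\<close>

lemma mat_adjoint_dim [simp]:
  "dim_row (mat_adjoint A) = dim_col A" "dim_col (mat_adjoint A) = dim_row A"
  by (auto simp: mat_adjoint_def)

lemma mat_adjoint_index [simp]:
  assumes "i < dim_col A" "j < dim_row A"
  shows "mat_adjoint A $$ (i, j) = conjugate (A $$ (j, i))"
  using assms unfolding mat_adjoint_def by (simp add: mat_of_rows_index)

lemma mat_adjoint_adjoint [simp]: "mat_adjoint (mat_adjoint A) = A"
  by (intro eq_matI) auto

lemma mat_adjoint_mult:
  fixes A B :: "complex mat"
  assumes "A \<in> carrier_mat n k" "B \<in> carrier_mat k l"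
  shows "mat_adjoint (A * B) = mat_adjoint B * mat_adjoint A"
  using assms by (intro eq_matI) (auto simp: scalar_prod_def mult.commute)

lemma unitary_mat_mult:
  assumes U: "unitary_mat n U" and V: "unitary_mat n V"
  shows "unitary_mat n (U * V)"
proof -
  define U' V' where "U' = mat_adjoint U" and "V' = mat_adjoint V"
  have c: "U \<in> carrier_mat n n" "V \<in> carrier_mat n n" "U' \<in> carrier_mat n n" "V' \<in> carrier_mat n n"
    and e: "U' * U = 1\<^sub>m n" "U * U' = 1\<^sub>m n" "V' * V = 1\<^sub>m n" "V * V' = 1\<^sub>m n"
    using U V mat_adjoint_carrier unfolding unitary_mat_def U'_def V'_def by auto
  note a = assoc_mult_mat[where ?n\<^sub>1.0 = n and ?n\<^sub>2.0 = n and ?n\<^sub>3.0 = n and ?n\<^sub>4.0 = n]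
  note m = mult_carrier_mat[where nr = n and n = n and nc = n]
  have ad: "mat_adjoint (U * V) = V' * U'"
    using mat_adjoint_mult[OF c(1,2)] by (simp add: U'_def V'_def)
  have "V' * U' * (U * V) = V' * ((U' * U) * V)" using c by (simp add: a m)
  also have "\<dots> = 1\<^sub>m n" using c e by (simp add: m)
  finally have 1: "V' * U' * (U * V) = 1\<^sub>m n" .
  have "U * V * (V' * U') = U * ((V * V') * U')" using c by (simp add: a m)
  also have "\<dots> = 1\<^sub>m n" using c e by (simp add: m)
  finally show ?thesis using 1 c by (simp add: unitary_mat_def ad m)
qed

lemma unitary_matI_cols:
  assumes U: "U \<in> carrier_mat n n"
    and orth: "\<And>i j. i < n \<Longrightarrow> j < n \<Longrightarrow> col U j \<bullet>c col U i = (if i = j then 1 else 0)"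
  shows "unitary_mat n U"
proof -
  have 1: "mat_adjoint U * U = 1\<^sub>m n"
  proof (rule eq_matI)
    fix i j assume ij: "i < dim_row (1\<^sub>m n :: complex mat)" "j < dim_col (1\<^sub>m n :: complex mat)"
    have "(mat_adjoint U * U) $$ (i, j) = col U j \<bullet>c col U i"
      using ij U by (auto simp: scalar_prod_def mult.commute)
    then show "(mat_adjoint U * U) $$ (i, j) = 1\<^sub>m n $$ (i, j)"
      using orth[of i j] ij by auto
  qed (use U in auto)
  then have "U * mat_adjoint U = 1\<^sub>m n"
    using mat_mult_left_right_inverse[OF mat_adjoint_carrier[OF U] U] by simp
  with 1 U show ?thesis by (simp add: unitary_mat_def)
qed

lemma cscalar_self_real:
  fixes v :: "complex vec"
  shows "v \<bullet>c v = complex_of_real (\<Sum>i<dim_vec v. (cmod (v $ i))\<^sup>2)"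
proof -
  have "v \<bullet>c v = (\<Sum>i = 0..<dim_vec v. complex_of_real ((cmod (v $ i))\<^sup>2))"
    by (simp only: scalar_prod_def dim_vec_conjugate)
       (rule sum.cong, auto simp: complex_norm_square simp del: of_real_power)
  then show ?thesis by (simp add: atLeast0LessThan)
qed

text \<open>Gram--Schmidt on a completion of \<open>v\<close> to a basis keeps \<open>v\<close> as its first vector but yields only
  pairwise orthogonal vectors, so each one is divided by its length.\<close>

lemma unitary_with_first_column:
  fixes v :: "complex vec"
  assumes v: "v \<in> carrier_vec n" and v0: "v \<noteq> 0\<^sub>v n"
  shows "\<exists>W c. unitary_mat n W \<and> col W 0 = c \<cdot>\<^sub>v v"
proof -
  interpret cof_vec_space n "TYPE(complex)" .
  define b where "b = basis_completion v"
  define ws where "ws = gram_schmidt n b"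
  note bc = basis_completion[OF v v0, folded b_def]
  have n: "n \<noteq> 0" using v v0 by auto
  obtain vs where bv: "b = v # vs" using bc(6,7) n by (cases b) auto
  have ws: "set ws \<subseteq> carrier_vec n" "corthogonal ws" "length ws = n"
    using gram_schmidt_result[OF bc(2,4,5) refl, folded ws_def] bc(6) by auto
  have hd: "hd ws = v" using gram_schmidt_hd[OF v, of vs, folded bv] unfolding ws_def .
  define c where "c w = complex_of_real (1 / sqrt (Re (w \<bullet>c w)))" for w :: "complex vec"
  define W where "W = mat_of_cols n (map (\<lambda>w. c w \<cdot>\<^sub>v w) ws)"
  have wi: "ws ! i \<in> carrier_vec n" if "i < n" for i using ws that by auto
  have W: "W \<in> carrier_mat n n" unfolding W_def using ws(3) by auto
  have colW: "col W i = c (ws ! i) \<cdot>\<^sub>v (ws ! i)" if "i < n" for i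
    unfolding W_def using that ws(3) wi[OF that] by (subst col_mat_of_cols) auto
  have "col W j \<bullet>c col W i = (if i = j then 1 else 0)" if ij: "i < n" "j < n" for i j
  proof -
    have "col W j \<bullet>c col W i = c (ws ! j) * cnj (c (ws ! i)) * (ws ! j \<bullet>c ws ! i)"
      using wi[OF ij(1)] wi[OF ij(2)] ij by (simp add: colW conjugate_smult_vec)
    moreover have nz: "(ws ! j \<bullet>c ws ! i = 0) = (i \<noteq> j)"
      using corthogonalD[OF ws(2), of j i] ij ws(3) by auto
    moreover have "c (ws ! i) * cnj (c (ws ! i)) * (ws ! i \<bullet>c ws ! i) = 1" if "i = j"
    proof -
      define s where "s = (\<Sum>k<dim_vec (ws ! i). (cmod (ws ! i $ k))\<^sup>2)"
      have s: "ws ! i \<bullet>c ws ! i = complex_of_real s" unfolding s_def by (rule cscalar_self_real)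
      have "s \<ge> 0" unfolding s_def by (intro sum_nonneg) auto
      moreover have "s \<noteq> 0" using s that nz by auto
      ultimately have "1 / sqrt s * (1 / sqrt s) * s = 1" by (simp add: field_simps)
      then show ?thesis unfolding c_def s
        by (metis Re_complex_of_real complex_cnj_complex_of_real of_real_1 of_real_mult)
    qed
    ultimately show ?thesis by auto
  qed
  then have "unitary_mat n W" by (rule unitary_matI_cols[OF W])
  moreover have "ws ! 0 = v" using hd ws(3) n by (cases ws) auto
  ultimately show ?thesis using colW[of 0] n by auto
qed

section \<open>The spectral theorem for Hermitian matrices\<close>

text \<open>Induction on the dimension, by deflation. In a unitary basis that starts with an eigenvector,
  the first column of the matrix is \<open>e\<close> times the first unit vector; since the matrix stays
  Hermitian, so is its first row, \<open>e\<close> is real, and the remaining block is Hermitian of one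
  dimension less.\<close>

lemma hermitian_spectral_decomp:
  assumes "A \<in> carrier_mat n n" "hermitian A"
  shows "\<exists>U d. spectral_decomp n A U d"
  using assms
proof (induction n arbitrary: A)
  case 0
  have "spectral_decomp 0 A (1\<^sub>m 0) (\<lambda>_. 0)"
    unfolding spectral_decomp_def unitary_mat_def using 0(1)
    by (auto intro!: eq_matI)
  then show ?case by blast
next
  case (Suc n)
  let ?N = "Suc n"
  note A = Suc.prems(1) and H = Suc.prems(2)
  obtain e v where "eigenvector A v e"
    using spectrum_non_empty[OF A] unfolding spectrum_def eigenvalue_def by auto
  then have v: "v \<in> carrier_vec ?N" "v \<noteq> 0\<^sub>v ?N" and ev: "A *\<^sub>v v = e \<cdot>\<^sub>v v"
    using A by (auto simp: eigenvector_def)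
  obtain W c where W: "unitary_mat ?N W" and W0: "col W 0 = c \<cdot>\<^sub>v v"
    using unitary_with_first_column[OF v] by blast
  define W' where "W' = mat_adjoint W"
  have Wc: "W \<in> carrier_mat ?N ?N" "W' \<in> carrier_mat ?N ?N"
    and We: "W' * W = 1\<^sub>m ?N" "W * W' = 1\<^sub>m ?N"
    using W mat_adjoint_carrier unfolding unitary_mat_def W'_def by auto
  note a = assoc_mult_mat[where ?n\<^sub>1.0 = ?N and ?n\<^sub>2.0 = ?N and ?n\<^sub>3.0 = ?N and ?n\<^sub>4.0 = ?N]
  note m = mult_carrier_mat[where nr = ?N and n = ?N and nc = ?N]
  define A' where "A' = W' * A * W"
  have A': "A' \<in> carrier_mat ?N ?N" using A Wc by (simp add: A'_def m)
  have "mat_adjoint A' = A'"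
    unfolding A'_def using A Wc H
    by (simp add: mat_adjoint_mult[of _ ?N ?N _ ?N] m a hermitian_def W'_def)
  then have sym: "A' $$ (i, j) = cnj (A' $$ (j, i))" if "i < ?N" "j < ?N" for i j
    using mat_adjoint_index[of i A' j] that A' by simp
  have "A' = W' * (A * W)" using A Wc by (simp add: A'_def a)
  then have "col A' 0 = W' *\<^sub>v (A *\<^sub>v col W 0)"
    using col_mult2[OF Wc(2) m[OF A Wc(1)], of 0] col_mult2[OF A Wc(1), of 0] by (simp del: col_mult2)
  also have "A *\<^sub>v col W 0 = e \<cdot>\<^sub>v col W 0"
    unfolding W0 using A v ev by (simp add: mult_mat_vec smult_smult_assoc mult.commute)
  also have "W' *\<^sub>v (e \<cdot>\<^sub>v col W 0) = e \<cdot>\<^sub>v col (W' * W) 0"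
    using Wc mult_mat_vec[of W' ?N ?N "col W 0" e] col_mult2[of W' ?N ?N W ?N 0]
      col_carrier_vec[of 0 ?N W ?N] by simp
  finally have col0: "col A' 0 = e \<cdot>\<^sub>v unit_vec ?N 0" by (simp add: We)
  have c0: "A' $$ (i, 0) = (if i = 0 then e else 0)" if "i < ?N" for i
    using arg_cong[OF col0, of "\<lambda>w. w $ i"] that A' by auto
  have e: "complex_of_real (Re e) = e"
    using sym[of 0 0] c0[of 0] by (simp add: complex_eq_iff)
  define A3 where "A3 = mat n n (\<lambda>(i, j). A' $$ (Suc i, Suc j))"
  have A3: "A3 \<in> carrier_mat n n" by (simp add: A3_def)
  have "hermitian A3"
    unfolding hermitian_def by (intro eq_matI) (simp_all add: A3_def sym[symmetric])
  then obtain U d where U: "unitary_mat n U"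
    and AU: "A3 = U * mat_diag n (\<lambda>i. complex_of_real (d i)) * mat_adjoint U"
    using Suc.IH[OF A3] unfolding spectral_decomp_def by blast
  define U' D where "U' = mat_adjoint U" and "D = mat_diag n (\<lambda>i. complex_of_real (d i))"
  have Uc: "U \<in> carrier_mat n n" "U' \<in> carrier_mat n n" "D \<in> carrier_mat n n"
    and Ue: "U' * U = 1\<^sub>m n" "U * U' = 1\<^sub>m n"
    using U mat_adjoint_carrier unfolding unitary_mat_def U'_def D_def by auto
  \<comment> \<open>Bordered versions of \<open>U\<close>, \<open>U'\<close> and \<open>D\<close>: the eigenvalue \<open>e\<close> is split off, so that
    \<open>P E P'\<close> recovers the matrix in the deflated basis.\<close>
  define P P' E where "P = four_block_mat (1\<^sub>m 1) (0\<^sub>m 1 n) (0\<^sub>m n 1) U"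
    and "P' = four_block_mat (1\<^sub>m 1) (0\<^sub>m 1 n) (0\<^sub>m n 1) U'"
    and "E = four_block_mat (e \<cdot>\<^sub>m 1\<^sub>m 1) (0\<^sub>m 1 n) (0\<^sub>m n 1) D"
  have Pc: "P \<in> carrier_mat ?N ?N" "P' \<in> carrier_mat ?N ?N" "E \<in> carrier_mat ?N ?N"
    using Uc by (auto simp: P_def P'_def E_def)
  have one: "four_block_mat (1\<^sub>m 1) (0\<^sub>m 1 n) (0\<^sub>m n 1) (1\<^sub>m n) = (1\<^sub>m ?N :: complex mat)"
    by (intro eq_matI) auto
  note mb = mult_four_block_mat[where ?nr1.0 = 1 and ?n1.0 = 1 and ?n2.0 = n and ?nr2.0 = n
      and ?nc1.0 = 1 and ?nc2.0 = n]
  have PP: "P' * P = 1\<^sub>m ?N" "P * P' = 1\<^sub>m ?N"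
    unfolding P_def P'_def using Uc Ue one by (simp_all add: mb)
  have Padj: "mat_adjoint P = P'"
    unfolding P_def P'_def U'_def
    by (intro eq_matI) (use Uc in auto)
  have Pu: "unitary_mat ?N P" using Pc PP Padj by (simp add: unitary_mat_def)
  have "P * E * P' = four_block_mat (e \<cdot>\<^sub>m 1\<^sub>m 1) (0\<^sub>m 1 n) (0\<^sub>m n 1) (U * D * U')"
    unfolding P_def P'_def E_def using Uc by (simp add: mb)
  also have "\<dots> = A'"
  proof -
    have r0: "A' $$ (0, j) = (if j = 0 then e else 0)" if "j < ?N" for j
      using sym[of 0 j] c0[OF that] c0[of 0] that by auto
    show ?thesis
      unfolding U'_def D_def AU[symmetric] using A' c0 r0
      by (intro eq_matI) (auto simp: A3_def)
  qed
  finally have PEP: "P * E * P' = A'" .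
  have E: "E = mat_diag ?N (\<lambda>i. complex_of_real (case i of 0 \<Rightarrow> Re e | Suc k \<Rightarrow> d k))"
    by (intro eq_matI) (auto simp: E_def D_def mat_diag_def e split: nat.splits)
  have "A = (W * W') * A * (W * W')" using A We by simp
  also have "\<dots> = W * A' * W'" unfolding A'_def using A Wc by (simp add: a m)
  also have "\<dots> = (W * P) * E * (P' * W')"
    unfolding PEP[symmetric] using Wc Pc by (simp add: a m)
  also have "P' * W' = mat_adjoint (W * P)"
    using Wc Pc Padj by (simp add: mat_adjoint_mult[of _ ?N ?N _ ?N] W'_def)
  finally have "spectral_decomp ?N A (W * P) (case_nat (Re e) d)"
    unfolding spectral_decomp_def E using unitary_mat_mult[OF W Pu] by simp
  then show ?case by blast
qed

lemma spectral_decomp_eigenvector: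
  assumes "spectral_decomp n A U d" "i < n"
  shows "A *\<^sub>v col U i = complex_of_real (d i) \<cdot>\<^sub>v col U i" "col U i \<bullet>c col U i = 1"
proof -
  define D where "D = mat_diag n (\<lambda>i. complex_of_real (d i))"
  have U: "U \<in> carrier_mat n n" "mat_adjoint U * U = 1\<^sub>m n"
    and A: "A = U * D * mat_adjoint U" and D: "D \<in> carrier_mat n n"
    using assms(1) by (auto simp: spectral_decomp_def unitary_mat_def D_def)
  note c = U(1) D mat_adjoint_carrier[OF U(1)]
  have "A * U = U * D * (mat_adjoint U * U)"
    unfolding A using c
    by (simp add: assoc_mult_mat[where ?n\<^sub>1.0 = n and ?n\<^sub>2.0 = n and ?n\<^sub>3.0 = n and ?n\<^sub>4.0 = n]
        mult_carrier_mat[where nr = n and n = n and nc = n])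
  also have "\<dots> = U * D" using c U(2) by (simp add: mult_carrier_mat[where nr = n and n = n and nc = n])
  finally have "col (A * U) i = col (U * D) i" by simp
  moreover have "col (A * U) i = A *\<^sub>v col U i"
    by (rule col_mult2[of _ n n _ n]) (use A c assms(2) in auto)
  moreover have "col (U * D) i = complex_of_real (d i) \<cdot>\<^sub>v col U i"
    unfolding D_def mat_diag_mult_right[OF U(1)] using U(1) assms(2)
    by (intro eq_vecI) auto
  ultimately show "A *\<^sub>v col U i = complex_of_real (d i) \<cdot>\<^sub>v col U i" by simp
  have "(mat_adjoint U * U) $$ (i, i) = col U i \<bullet>c col U i"
    using U(1) assms(2) by (auto simp: scalar_prod_def mult.commute)
  then show "col U i \<bullet>c col U i = 1" using U(2) assms(2) by simp
qed

lemma spectral_decomp_carrier: "spectral_decomp n A U d \<Longrightarrow> A \<in> carrier_mat n n"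
  by (auto simp: spectral_decomp_def unitary_mat_def dest: mat_adjoint_carrier)

text \<open>The quadratic forms through which Loewner bounds by multiples of the identity are read off
  at an eigenvector.\<close>

lemma rayleigh_scalar_diff:
  fixes A :: "complex mat" and c :: real
  assumes A: "A \<in> carrier_mat n n" and v: "v \<in> carrier_vec n" "v \<bullet>c v = 1"
    and ev: "A *\<^sub>v v = complex_of_real x \<cdot>\<^sub>v v"
  shows "((A - scalar_mat n c) *\<^sub>v v) \<bullet>c v = complex_of_real (x - c)"
    "((scalar_mat n c - A) *\<^sub>v v) \<bullet>c v = complex_of_real (c - x)"
proof -
  have s: "scalar_mat n c *\<^sub>v v = complex_of_real c \<cdot>\<^sub>v v"
    using v by (intro eq_vecI) (auto simp: smult_scalar_prod_distrib[where n = n])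
  have "(A - scalar_mat n c) *\<^sub>v v = complex_of_real (x - c) \<cdot>\<^sub>v v"
    using A v by (simp add: minus_mult_distrib_mat_vec[of _ n n] s ev)
      (auto intro!: eq_vecI simp: algebra_simps)
  then show "((A - scalar_mat n c) *\<^sub>v v) \<bullet>c v = complex_of_real (x - c)"
    using v by simp
  have "(scalar_mat n c - A) *\<^sub>v v = complex_of_real (c - x) \<cdot>\<^sub>v v"
    using A v by (simp add: minus_mult_distrib_mat_vec[of _ n n] s ev)
      (auto intro!: eq_vecI simp: algebra_simps)
  then show "((scalar_mat n c - A) *\<^sub>v v) \<bullet>c v = complex_of_real (c - x)"
    using v by simp
qed

text \<open>A Loewner inequality, tested on a unit eigenvector, becomes the same inequality for the
  eigenvalue.\<close>

lemma spectral_decomp_loewner_bounds: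
  assumes sd: "spectral_decomp n A U d" and i: "i < n"
  shows "loewner_le (scalar_mat n c) A \<Longrightarrow> c \<le> d i"
    and "loewner_le A (scalar_mat n c) \<Longrightarrow> d i \<le> c"
proof -
  have A: "A \<in> carrier_mat n n" by (rule spectral_decomp_carrier[OF sd])
  have v: "col U i \<in> carrier_vec n"
    using sd i by (auto simp: spectral_decomp_def unitary_mat_def)
  note r = rayleigh_scalar_diff[OF A v spectral_decomp_eigenvector(2,1)[OF sd i], of c]
  show "c \<le> d i" if "loewner_le (scalar_mat n c) A"
    using that v r(1) A unfolding loewner_le_def pos_semidefinite_def by fastforce
  show "d i \<le> c" if "loewner_le A (scalar_mat n c)"
    using that v r(2) A unfolding loewner_le_def pos_semidefinite_def by fastforce
qed

section \<open>Unitary invariance of the Schatten 2-norm\<close>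

lemma mat_trace_mult_commute:
  assumes "A \<in> carrier_mat n k" "B \<in> carrier_mat k n"
  shows "mat_trace (A * B) = mat_trace (B * A)"
proof -
  have "mat_trace (A * B) = (\<Sum>i<n. \<Sum>j<k. A $$ (i, j) * B $$ (j, i))"
    unfolding mat_trace_def using assms
    by (auto intro!: sum.cong simp: scalar_prod_def atLeast0LessThan)
  also have "\<dots> = (\<Sum>j<k. \<Sum>i<n. B $$ (j, i) * A $$ (i, j))"
    by (subst sum.swap) (simp add: mult.commute)
  also have "\<dots> = mat_trace (B * A)"
    unfolding mat_trace_def using assms
    by (auto intro!: sum.cong simp: scalar_prod_def atLeast0LessThan)
  finally show ?thesis .
qed

lemma schatten2_norm_entries:
  assumes "Y \<in> carrier_mat n k"
  shows "schatten2_norm Y = sqrt (\<Sum>j<k. \<Sum>i<n. (cmod (Y $$ (i, j)))\<^sup>2)"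
proof -
  have "mat_trace (mat_adjoint Y * Y) = (\<Sum>j<k. \<Sum>i<n. cnj (Y $$ (i, j)) * Y $$ (i, j))"
    unfolding mat_trace_def using assms
    by (auto intro!: sum.cong simp: scalar_prod_def atLeast0LessThan)
  also have "\<dots> = (\<Sum>j<k. \<Sum>i<n. complex_of_real ((cmod (Y $$ (i, j)))\<^sup>2))"
    by (intro sum.cong refl) (simp only: complex_norm_square mult.commute)
  finally have "mat_trace (mat_adjoint Y * Y) =
    complex_of_real (\<Sum>j<k. \<Sum>i<n. (cmod (Y $$ (i, j)))\<^sup>2)" by simp
  then show ?thesis unfolding schatten2_norm_def by (simp only: Re_complex_of_real)
qed

lemma schatten2_norm_unitary_mult:
  assumes U: "unitary_mat n U" and V: "unitary_mat k V" and Y: "Y \<in> carrier_mat n k"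
  shows "schatten2_norm (U * Y * mat_adjoint V) = schatten2_norm Y"
proof -
  define U' V' Y' where "U' = mat_adjoint U" and "V' = mat_adjoint V" and "Y' = mat_adjoint Y"
  have c: "U \<in> carrier_mat n n" "V \<in> carrier_mat k k" "U' \<in> carrier_mat n n"
    "V' \<in> carrier_mat k k" "Y' \<in> carrier_mat k n"
    and e: "U' * U = 1\<^sub>m n" "V' * V = 1\<^sub>m k"
    using U V Y mat_adjoint_carrier unfolding unitary_mat_def U'_def V'_def Y'_def by auto
  have YY: "Y' * Y \<in> carrier_mat k k" "Y * V' \<in> carrier_mat n k" "Y' * (Y * V') \<in> carrier_mat k k"
    using c Y by auto
  have "mat_adjoint (U * Y * V') = V * (Y' * U')"
    using c Y by (simp add: mat_adjoint_mult[of _ n k _ k] mat_adjoint_mult[of _ n n _ k]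
        U'_def V'_def Y'_def)
  then have "mat_adjoint (U * Y * V') * (U * Y * V') = V * (Y' * U') * (U * (Y * V'))"
    using c Y by (simp add: assoc_mult_mat[of _ n n _ k _ k])
  also have "\<dots> = V * (Y' * (U' * U) * (Y * V'))"
    using c Y YY by (simp add: assoc_mult_mat[of _ k k _ n _ k]
        assoc_mult_mat[of _ k n _ n _ k] assoc_mult_mat[of _ n n _ n _ k])
  also have "\<dots> = V * (Y' * Y * V')"
    using c Y by (simp add: e assoc_mult_mat[of _ k n _ k _ k])
  finally have "mat_trace (mat_adjoint (U * Y * V') * (U * Y * V')) = mat_trace (Y' * Y * V' * V)"
    using mat_trace_mult_commute[of V k k "Y' * Y * V'"] c YY by simp
  also have "Y' * Y * V' * V = Y' * Y"
    using c YY(1) right_mult_one_mat[OF YY(1)] by (simp add: assoc_mult_mat[of _ k k _ k _ k] e)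
  finally show ?thesis unfolding schatten2_norm_def V'_def Y'_def by simp
qed

section \<open>Schur multipliers\<close>

definition weight_entries :: "(nat \<Rightarrow> nat \<Rightarrow> real) \<Rightarrow> complex mat \<Rightarrow> complex mat" where
  "weight_entries k Y =
     mat (dim_row Y) (dim_col Y) (\<lambda>(i, j). complex_of_real (k i j) * Y $$ (i, j))"

lemma weight_entries_carrier: "Y \<in> carrier_mat n l \<Longrightarrow> weight_entries k Y \<in> carrier_mat n l"
  by (auto simp: weight_entries_def)

lemma weight_entries_add:
  "weight_entries k Y + weight_entries l Y = weight_entries (\<lambda>i j. k i j + l i j) Y"
  by (intro eq_matI) (auto simp: weight_entries_def algebra_simps)

lemma weight_entries_smult:
  "complex_of_real c \<cdot>\<^sub>m weight_entries k Y = weight_entries (\<lambda>i j. c * k i j) Y"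
  by (intro eq_matI) (auto simp: weight_entries_def)

text \<open>Two-sided multiplication by diagonal matrices acts entry by entry; this is what turns
  functional calculus into a weighting.\<close>

lemma mat_diag_mult_weight_entries:
  assumes Y: "Y \<in> carrier_mat n r"
  shows "mat_diag n (\<lambda>i. complex_of_real (f i)) * Y * mat_diag r (\<lambda>j. complex_of_real (g j))
    = weight_entries (\<lambda>i j. f i * g j) Y"
  unfolding mat_diag_mult_left[OF Y]
  by (subst mat_diag_mult_right[where nr = n])
    (use Y in \<open>auto intro!: eq_matI simp: weight_entries_def\<close>)

text \<open>Specific to the exponent 2: this norm depends only on the moduli of the entries, and
  monotonically so.\<close>

lemma schatten2_norm_weight_entries_mono:
  assumes Y: "Y \<in> carrier_mat n r" and C: "0 \<le> C"
    and le: "\<And>i j. i < n \<Longrightarrow> j < r \<Longrightarrow> \<bar>k i j\<bar> \<le> C * \<bar>l i j\<bar>"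
  shows "schatten2_norm (weight_entries k Y) \<le> C * schatten2_norm (weight_entries l Y)"
proof -
  have norm: "schatten2_norm (weight_entries h Y) =
      sqrt (\<Sum>j<r. \<Sum>i<n. (\<bar>h i j\<bar> * cmod (Y $$ (i, j)))\<^sup>2)" for h
    unfolding schatten2_norm_entries[OF weight_entries_carrier[OF Y]]
    by (intro arg_cong[of _ _ sqrt] sum.cong refl) (use Y in \<open>simp add: weight_entries_def norm_mult\<close>)
  have "(\<Sum>j<r. \<Sum>i<n. (\<bar>k i j\<bar> * cmod (Y $$ (i, j)))\<^sup>2)
      \<le> (\<Sum>j<r. \<Sum>i<n. (C * (\<bar>l i j\<bar> * cmod (Y $$ (i, j))))\<^sup>2)"
    using le by (intro sum_mono power_mono) (auto simp: mult.assoc[symmetric] intro!: mult_right_mono)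
  also have "\<dots> = C\<^sup>2 * (\<Sum>j<r. \<Sum>i<n. (\<bar>l i j\<bar> * cmod (Y $$ (i, j)))\<^sup>2)"
    by (simp only: power_mult_distrib[of C] sum_distrib_left)
  finally have "schatten2_norm (weight_entries k Y)
      \<le> sqrt (C\<^sup>2 * (\<Sum>j<r. \<Sum>i<n. (\<bar>l i j\<bar> * cmod (Y $$ (i, j)))\<^sup>2))"
    unfolding norm by (rule real_sqrt_le_mono)
  then show ?thesis unfolding norm using C by (simp add: real_sqrt_mult)
qed

text \<open>Entrywise weighting, carried out in the bases of \<open>\<complex>\<^sup>n\<close> given by the columns of \<open>U\<close> (for rows)
  and \<open>V\<close> (for columns). If these are eigenbases of \<open>A\<close> and \<open>B\<close> with eigenvalues \<open>a\<^sub>i\<close>, \<open>b\<^sub>j\<close>, the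
  weight \<open>f(a\<^sub>i) g(b\<^sub>j)\<close> gives \<open>f(A) X g(B)\<close>.\<close>

definition schur_multiplier ::
  "complex mat \<Rightarrow> complex mat \<Rightarrow> complex mat \<Rightarrow> (nat \<Rightarrow> nat \<Rightarrow> real) \<Rightarrow> complex mat" where
  "schur_multiplier U V X k = U * weight_entries k (mat_adjoint U * X * V) * mat_adjoint V"

lemma schur_multiplier_diag:
  assumes U: "unitary_mat n U" and V: "unitary_mat n V" and X: "X \<in> carrier_mat n n"
  shows "U * mat_diag n (\<lambda>i. complex_of_real (f i)) * mat_adjoint U * X *
      (V * mat_diag n (\<lambda>j. complex_of_real (g j)) * mat_adjoint V)
    = schur_multiplier U V X (\<lambda>i j. f i * g j)"
proof -
  define U' V' where "U' = mat_adjoint U" and "V' = mat_adjoint V"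
  define F G where "F = mat_diag n (\<lambda>i. complex_of_real (f i))"
    and "G = mat_diag n (\<lambda>j. complex_of_real (g j))"
  note a = assoc_mult_mat[where ?n\<^sub>1.0 = n and ?n\<^sub>2.0 = n and ?n\<^sub>3.0 = n and ?n\<^sub>4.0 = n]
  note m = mult_carrier_mat[where nr = n and n = n and nc = n]
  have c: "U \<in> carrier_mat n n" "V \<in> carrier_mat n n" "U' \<in> carrier_mat n n"
    "V' \<in> carrier_mat n n" "F \<in> carrier_mat n n" "G \<in> carrier_mat n n"
    using U V mat_adjoint_carrier by (auto simp: unitary_mat_def U'_def V'_def F_def G_def)
  have Y: "U' * X * V \<in> carrier_mat n n" using c X by (simp add: m)
  have "F * (U' * X * V) * G = weight_entries (\<lambda>i j. f i * g j) (U' * X * V)"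
    unfolding F_def G_def by (rule mat_diag_mult_weight_entries[OF Y])
  moreover have "U * F * U' * X * (V * G * V') = U * (F * (U' * X * V) * G) * V'"
    using c X by (simp add: a m)
  ultimately show ?thesis
    by (simp add: schur_multiplier_def U'_def V'_def F_def G_def)
qed

lemma schur_multiplier_linear:
  assumes U: "unitary_mat n U" and V: "unitary_mat n V" and X: "X \<in> carrier_mat n n"
  shows "schur_multiplier U V X k + schur_multiplier U V X l =
      schur_multiplier U V X (\<lambda>i j. k i j + l i j)"
    and "complex_of_real c \<cdot>\<^sub>m schur_multiplier U V X k = schur_multiplier U V X (\<lambda>i j. c * k i j)"
proof -
  define S where "S k = weight_entries k (mat_adjoint U * X * V)" for k
  have c: "U \<in> carrier_mat n n" "mat_adjoint V \<in> carrier_mat n n" "V \<in> carrier_mat n n"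
    "mat_adjoint U \<in> carrier_mat n n"
    using U V mat_adjoint_carrier by (auto simp: unitary_mat_def)
  have S: "S k \<in> carrier_mat n n" for k
    unfolding S_def using c X by (intro weight_entries_carrier mult_carrier_mat[where n = n])
  have US: "U * S k \<in> carrier_mat n n" for k using c S by (intro mult_carrier_mat[where n = n])
  show "schur_multiplier U V X k + schur_multiplier U V X l =
      schur_multiplier U V X (\<lambda>i j. k i j + l i j)"
    unfolding schur_multiplier_def weight_entries_add[symmetric] unfolding S_def[symmetric]
      mult_add_distrib_mat[OF c(1) S S] add_mult_distrib_mat[OF US US c(2)] ..
  show "complex_of_real c \<cdot>\<^sub>m schur_multiplier U V X k = schur_multiplier U V X (\<lambda>i j. c * k i j)"
    unfolding schur_multiplier_def weight_entries_smult[symmetric] unfolding S_def[symmetric]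
      mult_smult_distrib[OF c(1) S] mult_smult_assoc_mat[OF US c(2)] ..
qed

lemma schatten2_norm_schur_multiplier_mono:
  assumes U: "unitary_mat n U" and V: "unitary_mat n V" and X: "X \<in> carrier_mat n n"
    and C: "0 \<le> C"
    and le: "\<And>i j. i < n \<Longrightarrow> j < n \<Longrightarrow> \<bar>k i j\<bar> \<le> C * \<bar>l i j\<bar>"
  shows "schatten2_norm (schur_multiplier U V X k) \<le> C * schatten2_norm (schur_multiplier U V X l)"
proof -
  have Y: "mat_adjoint U * X * V \<in> carrier_mat n n"
    using U V X mat_adjoint_carrier unfolding unitary_mat_def
    by (intro mult_carrier_mat[where n = n]) auto
  show ?thesis
    unfolding schur_multiplier_def schatten2_norm_unitary_mult[OF U V weight_entries_carrier[OF Y]]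
    by (rule schatten2_norm_weight_entries_mono[OF Y C le])
qed

section \<open>The inequality between means\<close>

text \<open>The ratio of arithmetic to geometric mean depends only on \<open>a / b\<close> and grows as \<open>a / b\<close> moves
  away from 1, so over the square \<open>[m, M]\<close> times \<open>[m, M]\<close> it is largest at the corner \<open>(m, M)\<close>.
  After squaring, this is a factorisation.\<close>

lemma arith_geom_mean_ratio_le:
  fixes a b m M :: real
  assumes m: "0 < m" and a: "m \<le> a" "a \<le> M" and b: "m \<le> b" "b \<le> M"
  shows "(a + b) / (2 * sqrt (a * b)) \<le> (m + M) / (2 * sqrt (m * M))"
proof -
  have pos: "0 < a" "0 < b" "0 < M" using assms by auto
  \<comment> \<open>The two factors on the right are nonnegative because all four numbers lie between \<open>m\<close> and \<open>M\<close>.\<close>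
  have *: "(m + M)\<^sup>2 * (a * b) - (a + b)\<^sup>2 * (m * M) = (a * M - b * m) * (b * M - a * m)"
    by (simp add: power2_eq_square algebra_simps)
  have "b * m \<le> a * M" "a * m \<le> b * M"
    using mult_mono[OF b(2) a(1)] mult_mono[OF a(2) b(1)] pos m by (auto simp: mult.commute)
  then have "(a + b)\<^sup>2 * (m * M) \<le> (m + M)\<^sup>2 * (a * b)"
    using * mult_nonneg_nonneg[of "a * M - b * m" "b * M - a * m"] by linarith
  then have "sqrt ((a + b)\<^sup>2 * (m * M)) \<le> sqrt ((m + M)\<^sup>2 * (a * b))" by (rule real_sqrt_le_mono)
  then have "(a + b) * sqrt (m * M) \<le> (m + M) * sqrt (a * b)"
    using pos m by (simp add: real_sqrt_mult)
  then show ?thesis using pos m by (simp add: divide_simps mult.commute)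
qed

lemma heinz_mean_le_arith_mean:
  fixes a b \<nu> :: real
  assumes "0 < a" "0 < b" "0 \<le> \<nu>" "\<nu> \<le> 1"
  shows "(a powr \<nu> * b powr (1 - \<nu>) + a powr (1 - \<nu>) * b powr \<nu>) / 2 \<le> (a + b) / 2"
  using Youngs_inequality_0[of \<nu> "1 - \<nu>" a b] Youngs_inequality_0[of "1 - \<nu>" \<nu> a b] assms
  by (simp add: algebra_simps)

text \<open>With \<open>g\<close> the geometric mean and \<open>c\<close> the ratio of the arithmetic mean to \<open>g\<close>, the Heinz mean is at
  most the arithmetic mean \<open>g c = c\<^sup>1\<^sup>-\<^sup>\<nu> (g c\<^sup>\<nu>)\<close>. The first factor is bounded through the largest
  possible ratio, the second through Young's inequality \<open>c\<^sup>\<nu> \<le> 1 - \<nu> + \<nu> c\<close>.\<close>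

lemma heinz_mean_le:
  fixes a b m M \<nu> :: real
  assumes m: "0 < m" and a: "m \<le> a" "a \<le> M" and b: "m \<le> b" "b \<le> M"
    and \<nu>: "0 \<le> \<nu>" "\<nu> \<le> 1"
  shows "(a powr \<nu> * b powr (1 - \<nu>) + a powr (1 - \<nu>) * b powr \<nu>) / 2
    \<le> ((m + M) / (2 * sqrt (m * M))) powr (1 - \<nu>) *
      ((1 - \<nu>) * (a powr (1 / 2) * b powr (1 / 2)) + \<nu> * ((a + b) / 2))"
proof -
  have pos: "0 < a" "0 < b" using assms by auto
  define g c where "g = sqrt (a * b)" and "c = (a + b) / (2 * g)"
  have g: "0 < g" and c: "0 < c" and gc: "g * c = (a + b) / 2"
    using pos by (auto simp: g_def c_def)
  have cK: "c powr (1 - \<nu>) \<le> ((m + M) / (2 * sqrt (m * M))) powr (1 - \<nu>)"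
    using arith_geom_mean_ratio_le[OF m a b] c \<nu> unfolding c_def g_def by (intro powr_mono2) auto
  have young: "c powr \<nu> \<le> 1 - \<nu> + \<nu> * c"
    using Youngs_inequality_0[of "1 - \<nu>" \<nu> 1 c] \<nu> c by simp
  have "(a powr \<nu> * b powr (1 - \<nu>) + a powr (1 - \<nu>) * b powr \<nu>) / 2 \<le> (a + b) / 2"
    by (rule heinz_mean_le_arith_mean[OF pos \<nu>])
  also have "\<dots> = c powr (1 - \<nu>) * (g * c powr \<nu>)"
    using c gc by (simp add: powr_add[symmetric] mult.left_commute)
  also have "\<dots> \<le> c powr (1 - \<nu>) * (g * (1 - \<nu> + \<nu> * c))"
    using young g by (intro mult_left_mono) auto
  also have "\<dots> \<le> ((m + M) / (2 * sqrt (m * M))) powr (1 - \<nu>) * (g * (1 - \<nu> + \<nu> * c))"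
    using cK g c \<nu> by (intro mult_right_mono) auto
  also have "g * (1 - \<nu> + \<nu> * c) = (1 - \<nu>) * g + \<nu> * (g * c)" by (simp add: algebra_simps)
  also have "g = a powr (1 / 2) * b powr (1 / 2)"
    using pos by (simp add: g_def real_sqrt_mult powr_half_sqrt)
  also have "a powr (1 / 2) * b powr (1 / 2) * c = (a + b) / 2"
    using gc pos by (simp add: g_def real_sqrt_mult powr_half_sqrt)
  finally show ?thesis .
qed

section \<open>The Heinz-type norm inequality\<close>

theorem corollary3p5:
  fixes A B X :: "complex mat" and n :: nat and \<nu> m M :: real
  assumes "A \<in> carrier_mat n n" and "B \<in> carrier_mat n n" and "X \<in> carrier_mat n n"
    and "pos_definite A" and "pos_definite B"
    and "0 \<le> \<nu>" and "\<nu> \<le> 1"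
    and "0 < m" and "0 < M"
    and "loewner_le (scalar_mat n m) A" and "loewner_le A (scalar_mat n M)"
    and "loewner_le (scalar_mat n m) B" and "loewner_le B (scalar_mat n M)"
  shows "schatten2_norm
      ((1 / 2) \<cdot>\<^sub>m (mat_powr A \<nu> * X * mat_powr B (1 - \<nu>) + mat_powr A (1 - \<nu>) * X * mat_powr B \<nu>))
    \<le> ((m + M) / (2 * sqrt (m * M))) powr (1 - \<nu>) *
      schatten2_norm
        (complex_of_real (1 - \<nu>) \<cdot>\<^sub>m (mat_powr A (1 / 2) * X * mat_powr B (1 / 2)) +
         complex_of_real \<nu> \<cdot>\<^sub>m ((1 / 2) \<cdot>\<^sub>m (A * X + X * B)))"
proof -
  note X = assms(3)
  obtain U a where A: "spectral_decomp n A U a"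
    using hermitian_spectral_decomp[OF assms(1)] assms(4) by (auto simp: pos_definite_def)
  obtain V b where B: "spectral_decomp n B V b"
    using hermitian_spectral_decomp[OF assms(2)] assms(5) by (auto simp: pos_definite_def)
  have U: "unitary_mat n U" and V: "unitary_mat n V"
    using A B by (auto simp: spectral_decomp_def)
  have ab: "m \<le> a i" "a i \<le> M" "m \<le> b i" "b i \<le> M" if "i < n" for i
    using spectral_decomp_loewner_bounds[OF A that] spectral_decomp_loewner_bounds[OF B that]
      assms(10-13) by auto
  let ?T = "schur_multiplier U V X"
  have powr: "mat_powr A s * X * mat_powr B t = ?T (\<lambda>i j. a i powr s * b j powr t)" for s t
    unfolding mat_powr_def mat_fun_eq[OF A] mat_fun_eq[OF B] by (rule schur_multiplier_diag[OF U V X])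
  \<comment> \<open>\<open>A X\<close> and \<open>X B\<close> are the cases where the function applied to the other matrix is constantly 1.\<close>
  have one: "W * mat_diag n (\<lambda>i. complex_of_real 1) * mat_adjoint W = 1\<^sub>m n"
    if "unitary_mat n W" for W
    using that right_mult_one_mat[of W n n] by (simp add: unitary_mat_def)
  have AX: "A * X = ?T (\<lambda>i j. a i)"
    using schur_multiplier_diag[OF U V X, of a "\<lambda>_. 1"] A X assms(1)
    unfolding one[OF V] by (simp add: spectral_decomp_def mult_carrier_mat[where nr = n and n = n and nc = n])
  have XB: "X * B = ?T (\<lambda>i j. b j)"
    using schur_multiplier_diag[OF U V X, of "\<lambda>_. 1" b] B X
    unfolding one[OF U] by (simp add: spectral_decomp_def)
  have half: "(1 / 2 :: complex) = complex_of_real (1 / 2)" by simp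
  note T = schur_multiplier_linear[OF U V X]
  show ?thesis
    unfolding powr AX XB half T
  proof (rule schatten2_norm_schur_multiplier_mono[OF U V X])
    fix i j assume ij: "i < n" "j < n"
    have pos: "0 < a i" "0 < b j" using ab ij assms(8) by (force intro: less_le_trans)+
    show "\<bar>1 / 2 * (a i powr \<nu> * b j powr (1 - \<nu>) + a i powr (1 - \<nu>) * b j powr \<nu>)\<bar>
      \<le> ((m + M) / (2 * sqrt (m * M))) powr (1 - \<nu>) *
        \<bar>(1 - \<nu>) * (a i powr (1 / 2) * b j powr (1 / 2)) + \<nu> * (1 / 2 * (a i + b j))\<bar>"
      using heinz_mean_le[OF assms(8) ab(1,2)[OF ij(1)] ab(3,4)[OF ij(2)] assms(6,7)]
        pos assms(6,7) by (simp add: abs_of_nonneg)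
  qed simp
qed

end
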